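(* Let $0<\varepsilon<1/2$. Consider the following one-way two-party communication problem. There is a text $T$ of length $2n$ and a pattern $P$ of length $n$. Alice holds the first half $T[1,n]$ of the text and the whole pattern $P$; Bob holds the second half $T[n+1,2n]$ of the text and the whole pattern $P$. Alice sends a single message to Bob, after which Bob must output, for every alignment $i\in\{1,\dots,n+1\}$, a $(1+\varepsilon)$-approximation of the Hamming distance between $P$ and $T[i,i+n-1]$. This problem has one-way randomised communication complexity $\mathcal{O}(\varepsilon^{-4}\log^2 n)$ bits.
   Context: The Hamming distance between two strings of equal length is the number of positions at which they differ. A $(1+\varepsilon)$-approximation of a nonnegative quantity $h$ is a value $h'$ with $h\le h'\le(1+\varepsilon)h$. Randomised communication complexity here allows the players to use randomness, with the protocol required to succeed with constant probability. Throughout the paper it is assumed that $\varepsilon<1/2$. *)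

theory Defs
  imports "HOL-Probability.Probability"
begin

text \<open>A problem is given by the set \<open>D\<close> of admissible pairs (Alice's input, Bob's input) and
  the relation \<open>V x y z\<close>, ``\<open>z\<close> is a correct answer on inputs \<open>x\<close>, \<open>y\<close>''. A protocol is a pair of
  randomised maps using independent (private) coins: \<open>A x\<close> is the distribution of Alice's message,
  \<open>B y m\<close> the distribution of Bob's output on receiving \<open>m\<close>. Messages have length exactly \<open>c\<close>, so
  that no information is carried by the length.\<close>

definition one_way_protocol ::
  "('x \<times> 'y) set \<Rightarrow> ('x \<Rightarrow> 'y \<Rightarrow> 'z \<Rightarrow> bool) \<Rightarrow> nat \<Rightarrow>
    ('x \<Rightarrow> bool list pmf) \<Rightarrow> ('y \<Rightarrow> bool list \<Rightarrow> 'z pmf) \<Rightarrow> bool" where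
  "one_way_protocol D V c A B \<longleftrightarrow>
     (\<forall>(x, y)\<in>D. (\<forall>m\<in>set_pmf (A x). length m = c) \<and>
        measure_pmf.prob (bind_pmf (A x) (B y)) {z. V x y z} \<ge> 2 / 3)"

definition one_way_rand_cc ::
  "('x \<times> 'y) set \<Rightarrow> ('x \<Rightarrow> 'y \<Rightarrow> 'z \<Rightarrow> bool) \<Rightarrow> enat" where
  "one_way_rand_cc D V = Inf {enat c | c. \<exists>A B. one_way_protocol D V c A B}"

definition hamming :: "'a list \<Rightarrow> 'a list \<Rightarrow> nat" where
  "hamming u v = card {k. k < length u \<and> u ! k \<noteq> v ! k}"

text \<open>The substring $S[i, j]$, with 1-based inclusive bounds.\<close>

definition substr :: "'a list \<Rightarrow> nat \<Rightarrow> nat \<Rightarrow> 'a list" where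
  "substr S i j = take (j + 1 - i) (drop (i - 1) S)"

definition approximates :: "real \<Rightarrow> real \<Rightarrow> real \<Rightarrow> bool" where
  "approximates \<epsilon> h h' \<longleftrightarrow> h \<le> h' \<and> h' \<le> (1 + \<epsilon>) * h"

definition matching_inputs :: "nat \<Rightarrow> (('a list \<times> 'a list) \<times> ('a list \<times> 'a list)) set" where
  "matching_inputs n =
     {((substr T 1 n, P), (substr T (n + 1) (2 * n), P)) | T P. length T = 2 * n \<and> length P = n}"

text \<open>An answer \<open>h\<close> assigns the value \<open>h i\<close> to alignment \<open>i\<close>; its values outside \<open>{1..n + 1}\<close> are
  irrelevant. On \<open>matching_inputs\<close> the text is \<open>T1 @ T2\<close> and both players hold the same pattern.\<close>

definition matching_answer ::
  "real \<Rightarrow> nat \<Rightarrow> 'a list \<times> 'a list \<Rightarrow> 'a list \<times> 'a list \<Rightarrow> (nat \<Rightarrow> real) \<Rightarrow> bool" where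
  "matching_answer \<epsilon> n = (\<lambda>(T1, P) (T2, _) h.
     \<forall>i\<in>{1..n + 1}. approximates \<epsilon> (real (hamming P (substr (T1 @ T2) i (i + n - 1)))) (h i))"

end

theory Submission
  imports Defs "HOL-Probability.Hoeffding"
begin

text \<open>For every alignment, the part of the pattern that overlaps Bob's half of the text contributes a
  number of mismatches that Bob computes exactly, so Alice only has to convey the distances \<open>d s\<close>
  between the suffix of her half starting at position \<open>s\<close> and the prefix of \<open>P\<close> of
  that length.

  At each scale \<open>D = 2 ^ j\<close> she sends the least shift \<open>a\<close> with \<open>d a \<le>
  D\<close>. From \<open>a\<close> on her text is a copy of \<open>P\<close> shifted by \<open>a\<close> with at
  most \<open>D\<close> errors, and \<open>O(1/\<epsilon>)\<close> breakpoints cut it into blocks with fewer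
  than a small multiple of \<open>\<epsilon> D\<close> errors each. So for a shift \<open>s\<close> in scale,
  the text between \<open>s\<close> and the next breakpoint may be replaced by the shifted pattern, and the
  remaining suffix starts at a breakpoint \<open>u\<close>. For each breakpoint she sends
  \<open>O(\<epsilon>\<^sup>-\<^sup>2 log n)\<close> parities of random coins indexed by (position, symbol),
  whose bias makes two strings at distance \<open>x\<close> have parity correlation \<open>exp (- x /
  D)\<close>; this determines distances of order \<open>D\<close> up to a small multiple of \<open>\<epsilon>
  D\<close>, for all shifts at once. In total \<open>O(\<epsilon>\<^sup>-\<^sup>3 log\<^sup>2 n)\<close> bits.

  Bob need not invert the sketch: any text with the same message, for which the coins are equally accurate, has
  approximately the same distances. The coins are made private by Newman's argument, which needs a bounded
  alphabet; since both players know \<open>P\<close>, a symbol may be replaced by its first position in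
  \<open>P\<close>, and all symbols not in \<open>P\<close> may be identified.\<close>

section \<open>Parity sketches\<close>

definition coin_sign :: "bool \<Rightarrow> real" where
  "coin_sign b = (if b then -1 else 1)"

text \<open>A string enters as a map from positions to symbols. In multiplicative form the exclusive
  or of two parities is a product, so independence makes expectations factor.\<close>

definition sketch :: "('i \<times> 'c \<Rightarrow> bool) \<Rightarrow> 'i set \<Rightarrow> ('i \<Rightarrow> 'c) \<Rightarrow> real" where
  "sketch g I F = (\<Prod>m\<in>I. coin_sign (g (m, F m)))"

lemma sketch_in: "sketch g I F \<in> {1, -1}"
  unfolding sketch_def by (induction I rule: infinite_finite_induct) (auto simp: coin_sign_def)

text \<open>The bias gives every sign the mean \<open>exp (- 1 / (2 * D))\<close>. A mismatch
  involves two coins and therefore costs a factor \<open>exp (- 1 / D)\<close>.\<close>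

definition coin_table :: "('i \<times> 'c) set \<Rightarrow> real \<Rightarrow> ('i \<times> 'c \<Rightarrow> bool) pmf" where
  "coin_table A D = Pi_pmf A False (\<lambda>_. bernoulli_pmf ((1 - exp (- 1 / (2 * D))) / 2))"

lemma expectation_prod_sign:
  assumes "finite A" "J \<subseteq> A" "p \<in> {0..1}"
  shows "measure_pmf.expectation (Pi_pmf A False (\<lambda>_. bernoulli_pmf p)) (\<lambda>g. \<Prod>z\<in>J. coin_sign (g z))
    = (1 - 2 * p) ^ card J"
proof -
  define M where "M = Pi_pmf A False (\<lambda>_. bernoulli_pmf p)"
  have fin: "finite J"
    using assms finite_subset by blast
  have "prob_space.indep_vars (measure_pmf M) (\<lambda>_. count_space UNIV) (\<lambda>z g. g z) A"
    unfolding M_def by (rule indep_vars_Pi_pmf) fact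
  then have "prob_space.indep_vars (measure_pmf M) (\<lambda>_. borel) (\<lambda>z g. coin_sign (g z)) A"
    by (rule prob_space.indep_vars_compose2[OF measure_pmf.prob_space_axioms]) auto
  then have indep: "prob_space.indep_vars (measure_pmf M) (\<lambda>_. borel) (\<lambda>z g. coin_sign (g z)) J"
    by (rule prob_space.indep_vars_subset[OF measure_pmf.prob_space_axioms]) fact
  have int: "integrable (measure_pmf M) (\<lambda>g. coin_sign (g z))" for z
    by (rule measure_pmf.integrable_const_bound[where B = 1]) (auto simp: coin_sign_def)
  have single: "measure_pmf.expectation M (\<lambda>g. coin_sign (g z)) = 1 - 2 * p" if "z \<in> J" for z
  proof -
    have "map_pmf (\<lambda>g. g z) M = bernoulli_pmf p"
      unfolding M_def using assms that by (subst Pi_pmf_component) auto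
    then have "measure_pmf.expectation M (\<lambda>g. coin_sign (g z)) = measure_pmf.expectation (bernoulli_pmf p) coin_sign"
      using integral_map_pmf[of "\<lambda>g. g z" M coin_sign] by simp
    also have "\<dots> = 1 - 2 * p"
      using assms(3) by (simp add: coin_sign_def)
    finally show ?thesis .
  qed
  have "measure_pmf.expectation M (\<lambda>g. \<Prod>z\<in>J. coin_sign (g z))
      = (\<Prod>z\<in>J. measure_pmf.expectation M (\<lambda>g. coin_sign (g z)))"
    by (rule prob_space.indep_vars_lebesgue_integral[OF measure_pmf.prob_space_axioms fin indep int])
  also have "\<dots> = (1 - 2 * p) ^ card J"
    using single by simp
  finally show ?thesis
    unfolding M_def .
qed

text \<open>Where \<open>F\<close> and \<open>G\<close> agree, the same sign occurs twice and
  cancels; where they differ, two distinct coins survive. With \<open>h\<close> differing positions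
  the product is one of \<open>2 * h\<close> independent signs.\<close>

lemma expectation_sketch_mult:
  assumes "finite A" "finite I" "D > 0"
    and "\<And>m. m \<in> I \<Longrightarrow> (m, F m) \<in> A" "\<And>m. m \<in> I \<Longrightarrow> (m, G m) \<in> A"
  shows "measure_pmf.expectation (coin_table A D) (\<lambda>g. sketch g I F * sketch g I G)
    = exp (- real (card {m\<in>I. F m \<noteq> G m}) / D)"
proof -
  define I' where "I' = {m\<in>I. F m \<noteq> G m}"
  define J where "J = (\<lambda>m. (m, F m)) ` I' \<union> (\<lambda>m. (m, G m)) ` I'"
  define p where "p = (1 - exp (- 1 / (2 * D))) / 2"
  have p: "p \<in> {0..1}"
    using \<open>D > 0\<close> exp_ge_zero[of "- 1 / (2 * D)"] by (simp add: p_def del: exp_ge_zero)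
  have fin: "finite I'"
    using assms by (simp add: I'_def)
  have disj: "(\<lambda>m. (m, F m)) ` I' \<inter> (\<lambda>m. (m, G m)) ` I' = {}"
    by (auto simp: I'_def)
  have inj: "inj_on (\<lambda>m. (m, F m)) I'" "inj_on (\<lambda>m. (m, G m)) I'"
    by (auto intro: inj_onI)
  have "sketch g I F * sketch g I G = (\<Prod>z\<in>J. coin_sign (g z))" for g
  proof -
    have "sketch g I F * sketch g I G = (\<Prod>m\<in>I. coin_sign (g (m, F m)) * coin_sign (g (m, G m)))"
      by (simp add: sketch_def prod.distrib)
    also have "\<dots> = (\<Prod>m\<in>I'. coin_sign (g (m, F m)) * coin_sign (g (m, G m)))"
      using assms by (intro prod.mono_neutral_right) (auto simp: I'_def coin_sign_def)
    also have "\<dots> = (\<Prod>z\<in>J. coin_sign (g z))"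
      unfolding J_def using fin disj inj
      by (subst prod.union_disjoint) (auto simp: prod.reindex prod.distrib)
    finally show ?thesis .
  qed
  then have "measure_pmf.expectation (coin_table A D) (\<lambda>g. sketch g I F * sketch g I G)
      = (1 - 2 * p) ^ card J"
    unfolding coin_table_def p_def[symmetric] using assms p
    by (simp, intro expectation_prod_sign) (auto simp: J_def I'_def)
  also have "card J = 2 * card I'"
    unfolding J_def using fin disj inj by (subst card_Un_disjoint) (auto simp: card_image)
  also have "(1 - 2 * p) ^ (2 * card I') = exp (- real (card I') / D)"
  proof -
    have "(1 - 2 * p) ^ (2 * card I') = exp (real (2 * card I') * (- 1 / (2 * D)))"
      by (simp only: exp_of_nat_mult) (simp add: p_def field_simps)
    also have "real (2 * card I') * (- 1 / (2 * D)) = - real (card I') / D"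
      using \<open>D > 0\<close> by (simp add: field_simps)
    finally show ?thesis .
  qed
  finally show ?thesis
    unfolding I'_def .
qed

text \<open>Hoeffding's inequality for \<open>t\<close> independent products with values between -1
  and 1, whose common mean is known from \<open>expectation_sketch_mult\<close>.\<close>

lemma sketch_concentration:
  fixes F G :: "'i \<Rightarrow> 'c"
  assumes "finite A" "finite I" "D > 0" "t > 0" "\<tau> \<ge> 0"
    and "\<And>m. m \<in> I \<Longrightarrow> (m, F m) \<in> A" "\<And>m. m \<in> I \<Longrightarrow> (m, G m) \<in> A"
  shows "measure_pmf.prob (Pi_pmf {..<t} dflt (\<lambda>_. coin_table A D))
      {gs. \<bar>(\<Sum>i<t. sketch (gs i) I F * sketch (gs i) I G) / real t
             - exp (- real (card {m\<in>I. F m \<noteq> G m}) / D)\<bar> \<ge> \<tau>}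
    \<le> 2 * exp (- real t * \<tau>\<^sup>2 / 2)"
proof -
  define M where "M = Pi_pmf {..<t} dflt (\<lambda>_. coin_table A D)"
  define Z where "Z g = sketch g I F * sketch g I G" for g
  define E where "E = exp (- real (card {m\<in>I. F m \<noteq> G m}) / D)"
  have bound: "Z g \<in> {-1..1}" for g
    using sketch_in[of g I F] sketch_in[of g I G] by (auto simp: Z_def)
  have EZ: "measure_pmf.expectation M (\<lambda>gs. Z (gs i)) = E" if "i < t" for i
  proof -
    have "map_pmf (\<lambda>gs. gs i) M = coin_table A D"
      unfolding M_def using that by (subst Pi_pmf_component) auto
    then have "measure_pmf.expectation M (\<lambda>gs. Z (gs i)) = measure_pmf.expectation (coin_table A D) Z"
      using integral_map_pmf[of "\<lambda>gs. gs i" M Z] by simp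
    also have "\<dots> = E"
      unfolding Z_def E_def by (rule expectation_sketch_mult) fact+
    finally show ?thesis .
  qed
  have "prob_space.indep_vars (measure_pmf M) (\<lambda>_. count_space UNIV) (\<lambda>i gs. gs i) {..<t}"
    unfolding M_def by (rule indep_vars_Pi_pmf) auto
  then have indep: "prob_space.indep_vars (measure_pmf M) (\<lambda>_. borel) (\<lambda>i gs. Z (gs i)) {..<t}"
    by (rule prob_space.indep_vars_compose2[OF measure_pmf.prob_space_axioms]) auto
  interpret H: Hoeffding_ineq "measure_pmf M" "{..<t}" "\<lambda>i gs. Z (gs i)" "\<lambda>_. -1" "\<lambda>_. 1" "real t * E"
    by unfold_locales (use indep bound EZ in auto)
  have "measure_pmf.prob M {gs\<in>space (measure_pmf M). \<bar>(\<Sum>i<t. Z (gs i)) - real t * E\<bar> \<ge> real t * \<tau>}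
      \<le> 2 * exp (- 2 * (real t * \<tau>)\<^sup>2 / (\<Sum>i<t. (1 - (-1))\<^sup>2))"
    by (rule H.Hoeffding_ineq_abs_ge) (use \<open>t > 0\<close> \<open>\<tau> \<ge> 0\<close> in auto)
  also have "- 2 * (real t * \<tau>)\<^sup>2 / (\<Sum>i<t. (1 - (-1))\<^sup>2) = - real t * \<tau>\<^sup>2 / 2"
    using \<open>t > 0\<close> by (simp add: field_simps power2_eq_square)
  also have "{gs\<in>space (measure_pmf M). \<bar>(\<Sum>i<t. Z (gs i)) - real t * E\<bar> \<ge> real t * \<tau>}
      = {gs. \<bar>(\<Sum>i<t. Z (gs i)) / real t - E\<bar> \<ge> \<tau>}"
  proof -
    have "\<bar>x - real t * E\<bar> = real t * \<bar>x / real t - E\<bar>" for x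
      using \<open>t > 0\<close> by (simp add: abs_if field_simps)
    then show ?thesis
      using \<open>t > 0\<close> by simp
  qed
  finally show ?thesis
    unfolding M_def Z_def E_def .
qed

section \<open>From public to private coins\<close>

lemma pmf_exists_le_expectation:
  fixes f :: "'s \<Rightarrow> real"
  assumes "integrable (measure_pmf \<Omega>) f"
  shows "\<exists>\<omega>. f \<omega> \<le> measure_pmf.expectation \<Omega> f"
proof (rule ccontr)
  assume "\<not> ?thesis"
  then have lt: "measure_pmf.expectation \<Omega> f < f \<omega>" for \<omega>
    by (auto simp: not_le)
  have "measure_pmf.expectation \<Omega> (\<lambda>_. measure_pmf.expectation \<Omega> f) < measure_pmf.expectation \<Omega> f"
    by (rule measure_pmf.integral_less_AE_space)
      (use lt assms in \<open>auto simp: measure_pmf.emeasure_space_1\<close>)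
  then show False
    by simp
qed

text \<open>Newman's sampling argument, derandomised: the seeds are chosen one at a time so that the
  potential \<open>\<Sum>x. 64 ^ bad x\<close> at most doubles.\<close>

lemma exists_seeds_potential:
  fixes Bad :: "'k \<Rightarrow> 's set"
  assumes "finite X" "\<And>x. x \<in> X \<Longrightarrow> measure_pmf.prob \<Omega> (Bad x) \<le> 1 / 64"
  shows "\<exists>seed :: nat \<Rightarrow> 's. (\<Sum>x\<in>X. (64::real) ^ card {i. i < N \<and> seed i \<in> Bad x}) \<le> 2 ^ N * real (card X)"
proof (induction N)
  case 0
  then show ?case by simp
next
  case (Suc N)
  then obtain seed :: "nat \<Rightarrow> 's"
    where IH: "(\<Sum>x\<in>X. (64::real) ^ card {i. i < N \<and> seed i \<in> Bad x}) \<le> 2 ^ N * real (card X)"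
    by blast
  define c where "c x = (64::real) ^ card {i. i < N \<and> seed i \<in> Bad x}" for x
  \<comment> \<open>\<open>f \<omega>\<close> is the potential after appending
    \<open>\<omega>\<close> as a seed: the weight of \<open>x\<close> is multiplied by 64 if
    \<open>\<omega>\<close> is bad for \<open>x\<close> and by 1 otherwise.\<close>
  define f where "f \<omega> = (\<Sum>x\<in>X. c x * (1 + 63 * indicator (Bad x) \<omega>))" for \<omega>
  have int: "integrable (measure_pmf \<Omega>) (\<lambda>\<omega>. c x * (1 + 63 * indicator (Bad x) \<omega>))" for x
    by (intro integrable_mult_right Bochner_Integration.integrable_add measure_pmf.integrable_const
        integrable_real_indicator) (auto simp: measure_pmf.emeasure_eq_measure)
  have "measure_pmf.expectation \<Omega> f = (\<Sum>x\<in>X. c x * (1 + 63 * measure_pmf.prob \<Omega> (Bad x)))"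
  proof -
    have ind: "integrable (measure_pmf \<Omega>) (indicator (Bad x) :: 's \<Rightarrow> real)" for x
      by (intro integrable_real_indicator) (auto simp: measure_pmf.emeasure_eq_measure)
    have "measure_pmf.expectation \<Omega> (\<lambda>\<omega>. c x * (1 + 63 * indicator (Bad x) \<omega>))
        = c x * (1 + 63 * measure_pmf.prob \<Omega> (Bad x))" for x
      using Bochner_Integration.integral_add[OF measure_pmf.integrable_const[of \<Omega> "1::real"]
          integrable_mult_right[OF ind, of 63 x]] by simp
    then show ?thesis
      unfolding f_def by (simp only: Bochner_Integration.integral_sum[OF int])
  qed
  \<comment> \<open>The average growth factor is at most \<open>1 + 63 / 64\<close>.\<close>
  also have "\<dots> \<le> (\<Sum>x\<in>X. c x * 2)"
    using assms(2) by (intro sum_mono mult_left_mono) (force simp: c_def)+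
  also have "\<dots> \<le> 2 ^ Suc N * real (card X)"
    using IH by (simp add: c_def flip: sum_distrib_right)
  finally have Ef: "measure_pmf.expectation \<Omega> f \<le> 2 ^ Suc N * real (card X)" .
  have "integrable (measure_pmf \<Omega>) f"
    unfolding f_def using int by (intro Bochner_Integration.integrable_sum)
  then obtain \<omega> where \<omega>: "f \<omega> \<le> measure_pmf.expectation \<Omega> f"
    using pmf_exists_le_expectation by blast
  have "(\<Sum>x\<in>X. (64::real) ^ card {i. i < Suc N \<and> (seed(N := \<omega>)) i \<in> Bad x}) = f \<omega>"
    unfolding f_def
  proof (rule sum.cong[OF refl])
    fix x
    define B where "B = {i. i < N \<and> seed i \<in> Bad x}"
    have "{i. i < Suc N \<and> (seed(N := \<omega>)) i \<in> Bad x} = (if \<omega> \<in> Bad x then insert N B else B)"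
      by (auto simp: B_def less_Suc_eq)
    moreover have "finite B" "N \<notin> B"
      by (auto simp: B_def)
    ultimately show "(64::real) ^ card {i. i < Suc N \<and> (seed(N := \<omega>)) i \<in> Bad x}
        = c x * (1 + 63 * indicator (Bad x) \<omega>)"
      by (simp add: c_def flip: B_def)
  qed
  then have "(\<Sum>x\<in>X. (64::real) ^ card {i. i < Suc N \<and> (seed(N := \<omega>)) i \<in> Bad x}) \<le> 2 ^ Suc N * real (card X)"
    using \<omega> Ef by linarith
  then show ?case
    by (rule exI[of _ "seed(N := \<omega>)"])
qed

text \<open>A single term is at most the whole potential, so
  \<open>64 ^ b \<le> 2 ^ N * card X < 4 ^ N\<close>; as 64 is the cube of 4, this forces
  \<open>3 * b < N\<close>.\<close>

lemma exists_seeds_mostly_good: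
  fixes Bad :: "'k \<Rightarrow> 's set"
  assumes "finite X" "card X < 2 ^ N"
    and "\<And>x. x \<in> X \<Longrightarrow> measure_pmf.prob \<Omega> (Bad x) \<le> 1 / 64"
  shows "\<exists>seed :: nat \<Rightarrow> 's. \<forall>x\<in>X. 3 * card {i. i < N \<and> seed i \<in> Bad x} \<le> N"
proof -
  obtain seed :: "nat \<Rightarrow> 's"
    where pot: "(\<Sum>x\<in>X. (64::real) ^ card {i. i < N \<and> seed i \<in> Bad x}) \<le> 2 ^ N * real (card X)"
    using exists_seeds_potential[of X \<Omega> Bad N] assms(1,3) by blast
  have "3 * card {i. i < N \<and> seed i \<in> Bad x} \<le> N" if "x \<in> X" for x
  proof -
    define b where "b = card {i. i < N \<and> seed i \<in> Bad x}"
    have "(4::real) ^ (3 * b) = 64 ^ b"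
      by (simp add: power_mult)
    also have "\<dots> \<le> (\<Sum>x\<in>X. (64::real) ^ card {i. i < N \<and> seed i \<in> Bad x})"
      unfolding b_def using that assms(1) by (intro member_le_sum) auto
    also have "\<dots> \<le> 2 ^ N * real (card X)"
      by (rule pot)
    also have "\<dots> < 2 ^ N * 2 ^ N"
      using assms(2) by (intro mult_strict_left_mono) (simp_all add: of_nat_less_numeral_power_cancel_iff)
    also have "\<dots> = 4 ^ N"
      by (simp flip: power_mult_distrib)
    finally have "3 * b < N"
      by simp
    then show ?thesis
      by (simp add: b_def)
  qed
  then show ?thesis
    by blast
qed

text \<open>The \<open>N\<close> fixed seeds are part of the protocol; Alice draws an index
  privately and sends it along with her message. At most a third of the seeds is bad for any key,
  which gives success probability \<open>2 / 3\<close>. The map \<open>key\<close> reduces Alice's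
  input to what decides which seeds are bad, so that only the finitely many keys in \<open>X\<close>
  have to be served.\<close>

lemma one_way_protocol_exists:
  fixes Bad :: "'k \<Rightarrow> 's set" and msg :: "'s \<Rightarrow> 'x \<Rightarrow> 'm" and dec :: "'y \<Rightarrow> 's \<Rightarrow> 'm \<Rightarrow> 'z"
  assumes "finite X" "card X < 2 ^ N" "N > 0"
    and bad: "\<And>k. k \<in> X \<Longrightarrow> measure_pmf.prob \<Omega> (Bad k) \<le> 1 / 64"
    and key: "\<And>x y. (x, y) \<in> D \<Longrightarrow> key x \<in> X"
    and M: "finite M" "N * card M \<le> 2 ^ c"
    and msg: "\<And>x y \<omega>. (x, y) \<in> D \<Longrightarrow> msg \<omega> x \<in> M"
    and dec: "\<And>x y \<omega>. (x, y) \<in> D \<Longrightarrow> \<omega> \<notin> Bad (key x) \<Longrightarrow> V x y (dec y \<omega> (msg \<omega> x))"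
  shows "\<exists>A B. one_way_protocol D V c A B"
proof -
  obtain seed :: "nat \<Rightarrow> 's" where seed: "\<And>k. k \<in> X \<Longrightarrow> 3 * card {i. i < N \<and> seed i \<in> Bad k} \<le> N"
    using exists_seeds_mostly_good[of X N \<Omega> Bad] assms(1,2) bad by blast
  define W where "W = {bs::bool list. length bs = c}"
  have W: "finite W" "card W = 2 ^ c"
    using finite_lists_length_eq[of "UNIV :: bool set" c] card_lists_length_eq[of "UNIV :: bool set" c]
    by (simp_all add: W_def)
  have "card ({..<N} \<times> M) \<le> card W"
    using M W by (simp add: card_cartesian_product)
  \<comment> \<open>An injection into the bit strings of length exactly \<open>c\<close>, inverted
    by Bob with \<open>inv_into\<close>.\<close>
  then obtain enc where enc: "enc ` ({..<N} \<times> M) \<subseteq> W" "inj_on enc ({..<N} \<times> M)"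
    using card_le_inj[of "{..<N} \<times> M" W] M W by auto
  define A where "A x = map_pmf (\<lambda>i. enc (i, msg (seed i) x)) (pmf_of_set {..<N})" for x
  define B where "B y bs = return_pmf (case inv_into ({..<N} \<times> M) enc bs of (i, m) \<Rightarrow> dec y (seed i) m)" for y bs
  have ne: "{..<N} \<noteq> {}"
    using \<open>N > 0\<close> by auto
  have "one_way_protocol D V c A B"
    unfolding one_way_protocol_def
  proof (intro ballI, clarify, intro conjI ballI)
    fix x y bs
    assume D: "(x, y) \<in> D"
    { assume "bs \<in> set_pmf (A x)"
      then have "bs \<in> W"
        using enc(1) msg[OF D] ne by (auto simp: A_def)
      then show "length bs = c"
        by (simp add: W_def) }
    define Bd where "Bd = {i. i < N \<and> seed i \<in> Bad (key x)}"
    have out: "bind_pmf (A x) (B y) = map_pmf (\<lambda>i. dec y (seed i) (msg (seed i) x)) (pmf_of_set {..<N})"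
      unfolding A_def B_def map_pmf_def bind_assoc_pmf bind_return_pmf
      using enc(2) msg[OF D] ne by (intro bind_pmf_cong) auto
    have Bd: "Bd \<subseteq> {..<N}" "3 * card Bd \<le> N"
      using seed[OF key[OF D]] by (auto simp: Bd_def)
    have "2 / 3 \<le> real (card ({..<N} - Bd)) / real N"
    proof -
      have "card ({..<N} - Bd) = N - card Bd"
        using Bd by (subst card_Diff_subset) (auto intro: finite_subset)
      then have "2 * N \<le> 3 * card ({..<N} - Bd)"
        using Bd by simp
      then have "2 * real N \<le> 3 * real (card ({..<N} - Bd))"
        by linarith
      then show ?thesis
        using \<open>N > 0\<close> by (simp add: field_simps)
    qed
    also have "\<dots> \<le> real (card ({..<N} \<inter> {i. V x y (dec y (seed i) (msg (seed i) x))})) / real N"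
      using dec[OF D] by (intro divide_right_mono of_nat_mono card_mono) (auto simp: Bd_def)
    also have "\<dots> = measure_pmf.prob (bind_pmf (A x) (B y)) {z. V x y z}"
      unfolding out measure_map_pmf using ne by (subst measure_pmf_of_set) auto
    finally show "2 / 3 \<le> measure_pmf.prob (bind_pmf (A x) (B y)) {z. V x y z}" .
  qed
  then show ?thesis
    by (intro exI)
qed

section \<open>Anchors and breakpoints\<close>

text \<open>The set \<open>I\<close> of text positions is independent of the shift \<open>s\<close>
  because blocks starting at \<open>s\<close> are also compared at the anchor's shift.\<close>

definition mism :: "(nat \<Rightarrow> 'c) \<Rightarrow> (nat \<Rightarrow> 'c) \<Rightarrow> nat \<Rightarrow> nat set \<Rightarrow> nat" where
  "mism T P s I = card {m\<in>I. T m \<noteq> P (m - s)}"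

definition anchor :: "nat \<Rightarrow> real \<Rightarrow> (nat \<Rightarrow> 'c) \<Rightarrow> (nat \<Rightarrow> 'c) \<Rightarrow> nat" where
  "anchor n D T P = (LEAST s. real (mism T P s {s..<n}) \<le> D)"

text \<open>The \<open>0\<close> only guards against an empty set: if \<open>k * w\<close> exceeds the number of mismatches, the
  value is irrelevant.\<close>

definition breakpoint :: "nat \<Rightarrow> real \<Rightarrow> (nat \<Rightarrow> 'c) \<Rightarrow> (nat \<Rightarrow> 'c) \<Rightarrow> nat \<Rightarrow> nat \<Rightarrow> nat" where
  "breakpoint n w T P a k = Max (insert 0 {u. u \<le> n \<and> real k * w \<le> real (mism T P a {u..<n})})"

definition level_msg ::
  "nat \<Rightarrow> nat \<Rightarrow> nat \<Rightarrow> real \<Rightarrow> real \<Rightarrow> (nat \<Rightarrow> nat \<times> 'c \<Rightarrow> bool) \<Rightarrow> (nat \<Rightarrow> 'c) \<Rightarrow> (nat \<Rightarrow> 'c) \<Rightarrow>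
    nat \<times> (nat \<times> real list) list" where
  "level_msg n t K D w gs T P = (let a = anchor n D T P in
     (a, map (\<lambda>k. let u = breakpoint n w T P a k in
            (u, map (\<lambda>i. sketch (gs i) {u..<n} T) [0..<t])) [0..<K]))"

text \<open>Covers every possible breakpoint \<open>u\<close> and every shift \<open>s\<close>. For
  \<open>m < s\<close> the difference \<open>m - s\<close> truncates to 0, harmlessly: the sketch
  and \<open>mism\<close> see the same function of \<open>m\<close>.\<close>

definition accurate ::
  "nat \<Rightarrow> nat \<Rightarrow> real \<Rightarrow> real \<Rightarrow> (nat \<Rightarrow> nat \<times> 'c \<Rightarrow> bool) \<Rightarrow> (nat \<Rightarrow> 'c) \<Rightarrow> (nat \<Rightarrow> 'c) \<Rightarrow> bool" where
  "accurate n t D \<tau> gs T P \<longleftrightarrow> (\<forall>u\<le>n. \<forall>s\<le>n.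
     \<bar>(\<Sum>i<t. sketch (gs i) {u..<n} T * sketch (gs i) {u..<n} (\<lambda>m. P (m - s))) / real t
        - exp (- real (mism T P s {u..<n}) / D)\<bar> < \<tau>)"

lemma mism_split:
  assumes "s \<le> u" "u \<le> n"
  shows "mism T P a {s..<n} = mism T P a {s..<u} + mism T P a {u..<n}"
proof -
  have "{m\<in>{s..<n}. T m \<noteq> P (m - a)} = {m\<in>{s..<u}. T m \<noteq> P (m - a)} \<union> {m\<in>{u..<n}. T m \<noteq> P (m - a)}"
    using assms by auto
  then have "mism T P a {s..<n} = card ({m\<in>{s..<u}. T m \<noteq> P (m - a)} \<union> {m\<in>{u..<n}. T m \<noteq> P (m - a)})"
    by (simp only: mism_def)
  also have "\<dots> = mism T P a {s..<u} + mism T P a {u..<n}"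
    unfolding mism_def by (rule card_Un_disjoint) auto
  finally show ?thesis .
qed

lemma mism_mono: "finite J \<Longrightarrow> I \<subseteq> J \<Longrightarrow> mism T P s I \<le> mism T P s J"
  unfolding mism_def by (intro card_mono) auto

text \<open>If both texts carry \<open>P (m - a)\<close> at position \<open>m\<close>, they agree
  there. So one text may replace the other at the cost of the errors of both at shift
  \<open>a\<close>.\<close>

lemma mism_swap_text:
  assumes "finite I"
  shows "mism T P s I \<le> mism T P a I + mism T' P a I + mism T' P s I"
proof -
  have "{m\<in>I. T m \<noteq> P (m - s)} \<subseteq>
      ({m\<in>I. T m \<noteq> P (m - a)} \<union> {m\<in>I. T' m \<noteq> P (m - a)}) \<union> {m\<in>I. T' m \<noteq> P (m - s)}"
    by auto
  then have "mism T P s I \<le> card (({m\<in>I. T m \<noteq> P (m - a)} \<union> {m\<in>I. T' m \<noteq> P (m - a)}) \<union> {m\<in>I. T' m \<noteq> P (m - s)})"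
    unfolding mism_def using assms by (intro card_mono) auto
  also have "\<dots> \<le> mism T P a I + mism T' P a I + mism T' P s I"
    unfolding mism_def by (rule order_trans[OF card_Un_le add_right_mono[OF card_Un_le]])
  finally show ?thesis .
qed

text \<open>The shift \<open>n\<close> always qualifies, since its overlap is empty; hence the least
  shift exists.\<close>

lemma anchor_works:
  assumes "D \<ge> 0"
  shows "real (mism T P (anchor n D T P) {anchor n D T P..<n}) \<le> D" "anchor n D T P \<le> n"
proof -
  have "real (mism T P n {n..<n}) \<le> D"
    using assms by (simp add: mism_def)
  then show "real (mism T P (anchor n D T P) {anchor n D T P..<n}) \<le> D" "anchor n D T P \<le> n"
    unfolding anchor_def
    by (rule LeastI[of "\<lambda>s. real (mism T P s {s..<n}) \<le> D"], rule Least_le)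
qed

lemma anchor_le: "real (mism T P s {s..<n}) \<le> D \<Longrightarrow> anchor n D T P \<le> s"
  unfolding anchor_def by (rule Least_le)

lemma breakpoint_le: "breakpoint n w T P a k \<le> n"
  unfolding breakpoint_def by (subst Max_le_iff) auto

text \<open>Round the number of errors from \<open>s\<close> on down to a multiple
  \<open>k * w\<close>. Then \<open>s\<close> is a candidate for the \<open>k\<close>-th breakpoint,
  so the breakpoint is not before \<open>s\<close>, and fewer than \<open>w\<close> errors are left
  between the two.\<close>

lemma breakpoint_exists:
  assumes "s \<le> n" "w > 0" and K: "real (mism T P a {s..<n}) < real K * w"
  shows "\<exists>k<K. s \<le> breakpoint n w T P a k \<and> real (mism T P a {s..<breakpoint n w T P a k}) < w"
proof -
  define e where "e u = real (mism T P a {u..<n})" for u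
  define k where "k = nat \<lfloor>e s / w\<rfloor>"
  define u where "u = breakpoint n w T P a k"
  have "real k \<le> e s / w" "e s / w < real k + 1"
    using \<open>w > 0\<close> by (simp_all add: k_def e_def)
  then have k: "real k * w \<le> e s" "e s < real k * w + w"
    using \<open>w > 0\<close> by (simp_all add: field_simps)
  have "real k * w < real K * w"
    using k(1) K by (simp add: e_def del: mult_less_cancel_right)
  then have "k < K"
    using \<open>w > 0\<close> by simp
  define S where "S = {u. u \<le> n \<and> real k * w \<le> e u}"
  have S: "finite S" "s \<in> S"
    using k \<open>s \<le> n\<close> by (auto simp: S_def)
  have u_eq: "u = Max (insert 0 S)"
    by (simp add: u_def breakpoint_def S_def e_def)
  have "s \<le> u"
    unfolding u_eq using S by (intro Max_ge) auto
  \<comment> \<open>The guard \<open>0\<close> does no harm: if \<open>u = 0\<close>, then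
    \<open>s \<le> u\<close> gives \<open>u = s\<close>, which lies in \<open>S\<close>.\<close>
  have "u \<in> insert 0 S"
    unfolding u_eq using S by (intro Max_in) auto
  with \<open>s \<le> u\<close> S have "u \<in> S"
    by auto
  then have "u \<le> n" "real k * w \<le> e u"
    by (auto simp: S_def)
  with mism_split[OF \<open>s \<le> u\<close> \<open>u \<le> n\<close>, of T P a] k have "real (mism T P a {s..<u}) < w"
    by (simp add: e_def)
  with \<open>s \<le> u\<close> \<open>k < K\<close> show ?thesis
    by (auto simp: u_def)
qed

section \<open>Recovering distances from equal messages\<close>

lemma exp_minus_separation:
  fixes y y' \<eta> :: real
  assumes "y' \<le> 1" "0 < \<eta>" "\<eta> \<le> 1" and "exp (- y') - exp (- y) < \<eta> / 24"
  shows "y \<le> y' + \<eta> / 4"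
proof (rule ccontr)
  assume "\<not> ?thesis"
  then have y: "y' + \<eta> / 4 < y"
    by simp
  have "exp (- (\<eta> / 4)) = inverse (exp (\<eta> / 4))"
    by (rule exp_minus)
  also have "\<dots> \<le> inverse (1 + \<eta> / 4)"
    using assms by (intro le_imp_inverse_le exp_ge_add_one_self) auto
  also have "\<dots> \<le> 1 - \<eta> / 8"
    using assms by (simp add: field_simps)
  finally have e1: "exp (- (\<eta> / 4)) \<le> 1 - \<eta> / 8" .
  \<comment> \<open>As \<open>y' \<le> 1\<close>, the exponential is still at least
    \<open>1 / 3\<close> at \<open>y'\<close>. A gap above \<open>\<eta> / 4\<close> would lower it
    by at least \<open>1 / 3 * (\<eta> / 8)\<close>, which is the threshold
    \<open>\<eta> / 24\<close>.\<close>
  have "1 / 3 \<le> inverse (exp (1::real))"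
    using exp_le by (simp add: field_simps)
  also have "\<dots> = exp (- 1)"
    by (simp add: exp_minus)
  also have "\<dots> \<le> exp (- y')"
    using assms by simp
  finally have e2: "1 / 3 \<le> exp (- y')" .
  have "exp (- y) \<le> exp (- y' + - (\<eta> / 4))"
    using y by simp
  also have "\<dots> = exp (- y') * exp (- (\<eta> / 4))"
    by (rule exp_add)
  also have "\<dots> \<le> exp (- y') * (1 - \<eta> / 8)"
    using e1 by (intro mult_left_mono) auto
  finally have "exp (- y') * (\<eta> / 8) \<le> exp (- y') - exp (- y)"
    by (simp add: algebra_simps)
  moreover have "1 / 3 * (\<eta> / 8) \<le> exp (- y') * (\<eta> / 8)"
    using e2 assms by (intro mult_right_mono) auto
  ultimately show False
    using assms(4) by simp
qed

text \<open>The texts are compared across a common breakpoint \<open>u\<close>. Before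
  \<open>u\<close> both follow \<open>P\<close> shifted by the anchor with fewer than
  \<open>w\<close> errors each, costing at most \<open>2 * w = \<eta> * D / 4\<close>; after
  \<open>u\<close> the equal parities cost another \<open>\<eta> * D / 4\<close>. Only
  \<open>T'\<close> is assumed to be in scale, so a much larger distance for \<open>T\<close> is
  excluded as well.\<close>

lemma level_msg_determines_mism:
  fixes T T' P :: "nat \<Rightarrow> 'c"
  assumes "D > 0" "0 < \<eta>" "\<eta> \<le> 1" "8 / \<eta> < real K" "s \<le> n"
    and acc: "accurate n t D (\<eta> / 48) gs T P" "accurate n t D (\<eta> / 48) gs T' P"
    and eq: "level_msg n t K D (\<eta> * D / 8) gs T P = level_msg n t K D (\<eta> * D / 8) gs T' P"
    and small: "real (mism T' P s {s..<n}) \<le> D"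
  shows "real (mism T P s {s..<n}) \<le> real (mism T' P s {s..<n}) + \<eta> / 2 * D"
proof -
  define w where "w = \<eta> * D / 8"
  define a where "a = anchor n D T P"
  have "w > 0"
    using assms by (simp add: w_def)
  have a': "anchor n D T' P = a"
    using eq by (simp add: level_msg_def Let_def a_def)
  \<comment> \<open>The shift \<open>s\<close> is in scale for \<open>T'\<close>, and the equal
    messages make the anchor of \<open>T'\<close> that of \<open>T\<close>.\<close>
  have "a \<le> s"
    using anchor_le[OF small] a' by simp
  have blk: "\<forall>k\<in>{0..<K}. breakpoint n w T P a k = breakpoint n w T' P a k \<and>
      (\<forall>i\<in>{0..<t}. sketch (gs i) {breakpoint n w T P a k..<n} T = sketch (gs i) {breakpoint n w T' P a k..<n} T')"
    using eq unfolding level_msg_def Let_def a' a_def[symmetric] w_def[symmetric] prod.inject map_eq_conv set_upt by blast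
  have bp: "breakpoint n w T P a k = breakpoint n w T' P a k" if "k < K" for k
    using blk that by simp
  have sk: "sketch (gs i) {breakpoint n w T P a k..<n} T = sketch (gs i) {breakpoint n w T P a k..<n} T'"
    if "k < K" "i < t" for k i
    using bspec[OF conjunct2[OF bspec[OF blk, of k]], of i] bp[of k] that by simp
  \<comment> \<open>From the anchor on there are at most \<open>D = 8 / \<eta> * w\<close> errors,
    so \<open>K\<close> breakpoints suffice.\<close>
  have few: "real (mism U P a {s..<n}) < real K * w" if "anchor n D U P = a" for U
  proof -
    have "real (mism U P a {s..<n}) \<le> real (mism U P a {a..<n})"
      using \<open>a \<le> s\<close> by (intro of_nat_mono mism_mono) auto
    also have "\<dots> \<le> D"
      using anchor_works(1)[of D U P n] that \<open>D > 0\<close> by simp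
    also have "\<dots> = 8 / \<eta> * w"
      using assms by (simp add: w_def)
    also have "\<dots> < real K * w"
      using assms \<open>w > 0\<close> by (intro mult_strict_right_mono) auto
    finally show ?thesis .
  qed
  obtain k where k: "k < K" "s \<le> breakpoint n w T P a k" "real (mism T P a {s..<breakpoint n w T P a k}) < w"
    using breakpoint_exists[OF \<open>s \<le> n\<close> \<open>w > 0\<close> few[of T]] a_def by blast
  obtain k' where k': "k' < K" "s \<le> breakpoint n w T' P a k'" "real (mism T' P a {s..<breakpoint n w T' P a k'}) < w"
    using breakpoint_exists[OF \<open>s \<le> n\<close> \<open>w > 0\<close> few[OF a']] by blast
  \<comment> \<open>Each text has its own suitable breakpoint. The smaller one serves both, since it
    only shortens the initial block, and it is a breakpoint of either text because the lists
    agree.\<close>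
  obtain l where l: "l < K" "s \<le> breakpoint n w T P a l"
    "breakpoint n w T P a l \<le> breakpoint n w T P a k" "breakpoint n w T P a l \<le> breakpoint n w T' P a k'"
  proof (cases "breakpoint n w T P a k \<le> breakpoint n w T' P a k'")
    case True
    then show ?thesis
      using that[of k] k by simp
  next
    case False
    then show ?thesis
      using that[of k'] k' bp[of k'] by simp
  qed
  define u where "u = breakpoint n w T P a l"
  have u: "s \<le> u" "u \<le> n"
    using l breakpoint_le by (auto simp: u_def)
  have "mism T P a {s..<u} \<le> mism T P a {s..<breakpoint n w T P a k}"
    using l by (intro mism_mono) (auto simp: u_def)
  with k have w1: "real (mism T P a {s..<u}) < w"
    by linarith
  have "mism T' P a {s..<u} \<le> mism T' P a {s..<breakpoint n w T' P a k'}"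
    using l by (intro mism_mono) (auto simp: u_def)
  with k' have w2: "real (mism T' P a {s..<u}) < w"
    by linarith
  \<comment> \<open>Equal parities give both texts the same empirical correlation; two errors below
    \<open>\<eta> / 48\<close> add up to less than the threshold \<open>\<eta> / 24\<close>.\<close>
  define \<mu> where "\<mu> = (\<Sum>i<t. sketch (gs i) {u..<n} T * sketch (gs i) {u..<n} (\<lambda>m. P (m - s))) / real t"
  define x where "x = real (mism T P s {u..<n})"
  define x' where "x' = real (mism T' P s {u..<n})"
  have "\<mu> = (\<Sum>i<t. sketch (gs i) {u..<n} T' * sketch (gs i) {u..<n} (\<lambda>m. P (m - s))) / real t"
    unfolding \<mu>_def u_def using sk[OF l(1)] by simp
  then have "\<bar>\<mu> - exp (- x / D)\<bar> < \<eta> / 48" "\<bar>\<mu> - exp (- x' / D)\<bar> < \<eta> / 48"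
    using acc u \<open>s \<le> n\<close> by (auto simp: accurate_def \<mu>_def x_def x'_def)
  then have sep: "exp (- (x' / D)) - exp (- (x / D)) < \<eta> / 24"
    unfolding minus_divide_left by linarith
  have "x' \<le> D"
    using small mism_split[OF u, of T' P s] by (simp add: x'_def)
  then have "x / D \<le> x' / D + \<eta> / 4"
    using assms sep by (intro exp_minus_separation) auto
  then have "x \<le> x' + \<eta> / 4 * D"
    using \<open>D > 0\<close> by (simp add: field_simps)
  moreover have "mism T P s {s..<u} \<le> mism T P a {s..<u} + mism T' P a {s..<u} + mism T' P s {s..<u}"
    by (rule mism_swap_text) simp
  ultimately show ?thesis
    using w1 w2 mism_split[OF u, of T P s] mism_split[OF u, of T' P s]
    by (simp add: x_def x'_def w_def)
qed

text \<open>For positive \<open>v\<close>, the least scale with \<open>v \<le> 2 ^ j\<close> has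
  \<open>2 ^ j \<le> 2 * v\<close>, so the additive error \<open>\<eta> / 2 * 2 ^ j\<close> is at
  most \<open>\<eta> * v\<close>.\<close>

lemma levels_determine_mism:
  fixes T T' P :: "nat \<Rightarrow> 'c"
  assumes "0 < \<eta>" "\<eta> \<le> 1" "8 / \<eta> < real K" "s \<le> n" "n \<le> 2 ^ J"
    and acc: "\<And>j. j \<le> J \<Longrightarrow> accurate n t (2 ^ j) (\<eta> / 48) (gs j) T P"
      "\<And>j. j \<le> J \<Longrightarrow> accurate n t (2 ^ j) (\<eta> / 48) (gs j) T' P"
    and eq: "\<And>j. j \<le> J \<Longrightarrow> level_msg n t K (2 ^ j) (\<eta> * 2 ^ j / 8) (gs j) T P
        = level_msg n t K (2 ^ j) (\<eta> * 2 ^ j / 8) (gs j) T' P"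
  shows "real (mism T P s {s..<n}) \<le> (1 + \<eta>) * real (mism T' P s {s..<n})"
proof -
  define v where "v = mism T' P s {s..<n}"
  have step: "real (mism T P s {s..<n}) \<le> real v + \<eta> / 2 * 2 ^ j" if "j \<le> J" "v \<le> 2 ^ j" for j
    using level_msg_determines_mism[OF _ assms(1-4) acc(1)[OF that(1)] acc(2)[OF that(1)] eq[OF that(1)]] that(2)
    by (simp add: v_def)
  have "v \<le> card {s..<n}"
    unfolding v_def mism_def by (intro card_mono) auto
  then have "v \<le> 2 ^ J"
    using assms by simp
  show ?thesis
  proof (cases "v = 0")
    case True
    \<comment> \<open>At scale 1 the error is at most \<open>1 / 2\<close>, and the distance is an
      integer.\<close>
    with step[of 0] assms have "mism T P s {s..<n} = 0"
      by simp
    then show ?thesis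
      using assms by simp
  next
    case False
    define j where "j = (LEAST j. v \<le> 2 ^ j)"
    have "v \<le> 2 ^ j" "j \<le> J"
      unfolding j_def using \<open>v \<le> 2 ^ J\<close> by (rule LeastI, rule Least_le)
    have "2 ^ j \<le> 2 * v"
    proof (cases j)
      case (Suc i)
      then have "\<not> v \<le> 2 ^ i"
        using not_less_Least[of i "\<lambda>j. v \<le> 2 ^ j"] by (simp add: j_def)
      then show ?thesis
        using Suc by simp
    qed (use False in auto)
    then have "real (2 ^ j) \<le> real (2 * v)"
      by (simp only: of_nat_le_iff)
    then have "(2::real) ^ j \<le> 2 * real v"
      by simp
    then have "\<eta> / 2 * 2 ^ j \<le> \<eta> / 2 * (2 * real v)"
      using assms by (intro mult_left_mono) auto
    with step[OF \<open>j \<le> J\<close> \<open>v \<le> 2 ^ j\<close>] show ?thesis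
      by (simp add: v_def algebra_simps)
  qed
qed

section \<open>Failure probability of the coins\<close>

lemma prob_not_accurate:
  fixes T P :: "nat \<Rightarrow> nat"
  assumes "D > 0" "t > 0" "\<tau> \<ge> 0" "\<And>m. m < n \<Longrightarrow> T m \<le> n" "\<And>m. m < n \<Longrightarrow> P m \<le> n"
  shows "measure_pmf.prob (Pi_pmf {..<t} dflt (\<lambda>_. coin_table ({..<n} \<times> {..n}) D))
      {gs. \<not> accurate n t D \<tau> gs T P} \<le> real ((n + 1)\<^sup>2) * (2 * exp (- real t * \<tau>\<^sup>2 / 2))"
proof -
  define M where "M = Pi_pmf {..<t} dflt (\<lambda>_. coin_table ({..<n} \<times> {..n}) D)"
  define E where "E = (\<lambda>(u, s). {gs. \<tau> \<le> \<bar>(\<Sum>i<t. sketch (gs i) {u..<n} T * sketch (gs i) {u..<n} (\<lambda>m. P (m - s))) / real t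
        - exp (- real (mism T P s {u..<n}) / D)\<bar>})"
  have single: "measure_pmf.prob M (E us) \<le> 2 * exp (- real t * \<tau>\<^sup>2 / 2)" for us
    unfolding M_def E_def mism_def case_prod_unfold using assms
    by (intro sketch_concentration) auto
  have "{gs. \<not> accurate n t D \<tau> gs T P} = (\<Union>us\<in>{..n} \<times> {..n}. E us)"
    unfolding accurate_def E_def by (auto simp: not_less)
  then have "measure_pmf.prob M {gs. \<not> accurate n t D \<tau> gs T P} \<le> (\<Sum>us\<in>{..n} \<times> {..n}. measure_pmf.prob M (E us))"
    by (simp only:) (intro measure_pmf.finite_measure_subadditive_finite; auto)
  also have "\<dots> \<le> (\<Sum>us\<in>{..n} \<times> {..n}. 2 * exp (- real t * \<tau>\<^sup>2 / 2))"
    by (intro sum_mono single)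
  also have "\<dots> = real ((n + 1)\<^sup>2) * (2 * exp (- real t * \<tau>\<^sup>2 / 2))"
    by (simp add: power2_eq_square)
  finally show ?thesis
    unfolding M_def .
qed

definition seeds :: "nat \<Rightarrow> nat \<Rightarrow> nat \<Rightarrow> (nat \<Rightarrow> nat \<Rightarrow> nat \<times> nat \<Rightarrow> bool) pmf" where
  "seeds n t J = Pi_pmf {..J} (\<lambda>_ _. False)
     (\<lambda>j. Pi_pmf {..<t} (\<lambda>_. False) (\<lambda>_. coin_table ({..<n} \<times> {..n}) (2 ^ j)))"

lemma prob_seeds_not_accurate:
  fixes T P :: "nat \<Rightarrow> nat"
  assumes "t > 0" "\<tau> \<ge> 0" "\<And>m. m < n \<Longrightarrow> T m \<le> n" "\<And>m. m < n \<Longrightarrow> P m \<le> n"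
  shows "measure_pmf.prob (seeds n t J) {\<omega>. \<exists>j\<le>J. \<not> accurate n t (2 ^ j) \<tau> (\<omega> j) T P}
    \<le> real (J + 1) * (real ((n + 1)\<^sup>2) * (2 * exp (- real t * \<tau>\<^sup>2 / 2)))"
proof -
  have single: "measure_pmf.prob (seeds n t J) {\<omega>. \<not> accurate n t (2 ^ j) \<tau> (\<omega> j) T P}
      \<le> real ((n + 1)\<^sup>2) * (2 * exp (- real t * \<tau>\<^sup>2 / 2))" if "j \<le> J" for j
  proof -
    have "measure_pmf.prob (seeds n t J) {\<omega>. \<not> accurate n t (2 ^ j) \<tau> (\<omega> j) T P}
        = measure_pmf.prob (map_pmf (\<lambda>\<omega>. \<omega> j) (seeds n t J)) {gs. \<not> accurate n t (2 ^ j) \<tau> gs T P}"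
      by (simp add: vimage_def)
    also have "map_pmf (\<lambda>\<omega>. \<omega> j) (seeds n t J) = Pi_pmf {..<t} (\<lambda>_. False) (\<lambda>_. coin_table ({..<n} \<times> {..n}) (2 ^ j))"
      unfolding seeds_def using that by (subst Pi_pmf_component) auto
    also have "measure_pmf.prob \<dots> {gs. \<not> accurate n t (2 ^ j) \<tau> gs T P}
        \<le> real ((n + 1)\<^sup>2) * (2 * exp (- real t * \<tau>\<^sup>2 / 2))"
      by (rule prob_not_accurate) (use assms in auto)
    finally show ?thesis .
  qed
  have "{\<omega>. \<exists>j\<le>J. \<not> accurate n t (2 ^ j) \<tau> (\<omega> j) T P} = (\<Union>j\<in>{..J}. {\<omega>. \<not> accurate n t (2 ^ j) \<tau> (\<omega> j) T P})"
    by auto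
  then have "measure_pmf.prob (seeds n t J) {\<omega>. \<exists>j\<le>J. \<not> accurate n t (2 ^ j) \<tau> (\<omega> j) T P}
      \<le> (\<Sum>j\<in>{..J}. measure_pmf.prob (seeds n t J) {\<omega>. \<not> accurate n t (2 ^ j) \<tau> (\<omega> j) T P})"
    by (simp only:) (intro measure_pmf.finite_measure_subadditive_finite; auto)
  also have "\<dots> \<le> (\<Sum>j\<in>{..J}. real ((n + 1)\<^sup>2) * (2 * exp (- real t * \<tau>\<^sup>2 / 2)))"
    by (intro sum_mono single) auto
  also have "\<dots> = real (J + 1) * (real ((n + 1)\<^sup>2) * (2 * exp (- real t * \<tau>\<^sup>2 / 2)))"
    by simp
  finally show ?thesis .
qed

section \<open>The protocol\<close>

definition label :: "'a list \<Rightarrow> 'a \<Rightarrow> nat" where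
  "label P c = (if c \<in> set P then LEAST i. P ! i = c else length P)"

lemma label_in_set:
  assumes "c \<in> set P"
  shows "label P c < length P" "P ! label P c = c"
proof -
  obtain i where i: "i < length P" "P ! i = c"
    using assms by (auto simp: in_set_conv_nth)
  then have "(LEAST i. P ! i = c) \<le> i"
    by (intro Least_le)
  with i assms show "label P c < length P"
    by (simp add: label_def)
  show "P ! label P c = c"
    using LeastI[of "\<lambda>i. P ! i = c", OF i(2)] assms by (simp add: label_def)
qed

lemma label_le: "label P c \<le> length P"
  using label_in_set(1)[of c P] by (cases "c \<in> set P") (auto simp: label_def)

text \<open>Distinct symbols outside \<open>P\<close> share the label \<open>length P\<close>.
  Nothing is lost, because text symbols are only compared with symbols of \<open>P\<close>, whose
  labels are smaller.\<close>

lemma label_eq_iff: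
  assumes "c' \<in> set P"
  shows "label P c = label P c' \<longleftrightarrow> c = c'"
proof (cases "c \<in> set P")
  case True
  then show ?thesis
    using assms label_in_set(2) by metis
next
  case False
  then have "label P c = length P"
    by (simp add: label_def)
  then show ?thesis
    using False assms label_in_set(1)[OF assms] by auto
qed

definition overhang :: "nat \<Rightarrow> 'a list \<Rightarrow> 'a list \<Rightarrow> nat \<Rightarrow> nat" where
  "overhang n P T2 s = card {k. n - s \<le> k \<and> k < n \<and> P ! k \<noteq> T2 ! (s + k - n)}"

lemma hamming_alignment:
  assumes "length T1 = n" "length T2 = n" "length P = n" "i \<in> {1..n + 1}"
  shows "hamming P (substr (T1 @ T2) i (i + n - 1))
    = mism (nth (map (label P) T1)) (nth (map (label P) P)) (i - 1) {i - 1..<n} + overhang n P T2 (i - 1)"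
proof -
  define s where "s = i - 1"
  have s: "s \<le> n" "i = s + 1"
    using assms by (auto simp: s_def)
  define L where "L = {k. k < n - s \<and> P ! k \<noteq> T1 ! (s + k)}"
  define R where "R = {k. n - s \<le> k \<and> k < n \<and> P ! k \<noteq> T2 ! (s + k - n)}"
  have "substr (T1 @ T2) i (i + n - 1) = take n (drop s (T1 @ T2))"
    using s by (simp add: substr_def)
  moreover have "take n (drop s (T1 @ T2)) ! k = (if k < n - s then T1 ! (s + k) else T2 ! (s + k - n))"
    if "k < n" for k
    using that s assms by (auto simp: nth_append add.commute)
  ultimately have nth: "substr (T1 @ T2) i (i + n - 1) ! k = (if k < n - s then T1 ! (s + k) else T2 ! (s + k - n))"
    if "k < n" for k
    using that by (simp only:)
  have "{k. k < length P \<and> P ! k \<noteq> substr (T1 @ T2) i (i + n - 1) ! k} = L \<union> R"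
  proof (rule set_eqI)
    fix k
    show "k \<in> {k. k < length P \<and> P ! k \<noteq> substr (T1 @ T2) i (i + n - 1) ! k} \<longleftrightarrow> k \<in> L \<union> R"
      by (cases "k < n"; cases "k < n - s") (use nth[of k] assms(3) in \<open>simp_all add: L_def R_def\<close>)
  qed
  then have "hamming P (substr (T1 @ T2) i (i + n - 1)) = card (L \<union> R)"
    by (simp only: hamming_def)
  also have "\<dots> = card L + card R"
    by (rule card_Un_disjoint) (auto simp: L_def R_def)
  \<comment> \<open>Translation by \<open>s\<close> turns pattern positions into the text positions
    counted by \<open>mism\<close>.\<close>
  also have "card L = card ((+) s ` L)"
    by (simp add: card_image)
  also have "(+) s ` L = {m\<in>{s..<n}. T1 ! m \<noteq> P ! (m - s)}"
  proof (intro equalityI subsetI)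
    fix m assume "m \<in> {m\<in>{s..<n}. T1 ! m \<noteq> P ! (m - s)}"
    then have "m = s + (m - s)" "m - s \<in> L"
      by (auto simp: L_def)
    then show "m \<in> (+) s ` L"
      by (rule image_eqI)
  qed (auto simp: L_def)
  also have "\<dots> = {m\<in>{s..<n}. map (label P) T1 ! m \<noteq> map (label P) P ! (m - s)}"
    using assms s by (intro Collect_cong conj_cong refl) (auto simp: label_eq_iff)
  finally show ?thesis
    unfolding mism_def overhang_def R_def s_def .
qed

section \<open>Encoding and decoding the message\<close>

definition level_msgs ::
  "nat \<Rightarrow> nat \<Rightarrow> nat \<Rightarrow> nat \<Rightarrow> real \<Rightarrow> (nat \<Rightarrow> nat \<Rightarrow> nat \<times> nat \<Rightarrow> bool) \<Rightarrow> nat list \<Rightarrow> nat list \<Rightarrow>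
    (nat \<times> (nat \<times> real list) list) list" where
  "level_msgs n t K J \<eta> \<omega> T P =
     map (\<lambda>j. level_msg n t K (2 ^ j) (\<eta> * 2 ^ j / 8) (\<omega> j) (nth T) (nth P)) [0..<J + 1]"

definition lists_of :: "'b set \<Rightarrow> nat \<Rightarrow> 'b list set" where
  "lists_of A k = {xs. set xs \<subseteq> A \<and> length xs = k}"

lemma finite_lists_of: "finite A \<Longrightarrow> finite (lists_of A k)"
  unfolding lists_of_def by (rule finite_lists_length_eq)

lemma card_lists_of: "finite A \<Longrightarrow> card (lists_of A k) = card A ^ k"
  unfolding lists_of_def by (rule card_lists_length_eq)

definition msg_space :: "nat \<Rightarrow> nat \<Rightarrow> nat \<Rightarrow> nat \<Rightarrow> (nat \<times> (nat \<times> real list) list) list set" where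
  "msg_space n t K J = lists_of ({..n} \<times> lists_of ({..n} \<times> lists_of {1, -1} t) K) (J + 1)"

lemma finite_msg_space: "finite (msg_space n t K J)"
  unfolding msg_space_def by (intro finite_lists_of finite_cartesian_product) auto

lemma card_msg_space: "card (msg_space n t K J) = ((n + 1) * ((n + 1) * 2 ^ t) ^ K) ^ (J + 1)"
proof -
  have "card (lists_of {1, -1 :: real} t) = 2 ^ t"
    by (subst card_lists_of) (auto simp: numeral_2_eq_2)
  then show ?thesis
    unfolding msg_space_def
    by (simp add: card_lists_of finite_lists_of card_cartesian_product)
qed

lemma level_msgs_in_msg_space: "level_msgs n t K J \<eta> \<omega> T P \<in> msg_space n t K J"
proof -
  have "level_msg n t K (2 ^ j) (\<eta> * 2 ^ j / 8) (\<omega> j) (nth T) (nth P)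
      \<in> {..n} \<times> lists_of ({..n} \<times> lists_of {1, -1} t) K" for j
    by (simp add: level_msg_def Let_def lists_of_def image_subset_iff anchor_works(2) breakpoint_le sketch_in
        del: insert_iff)
  then show ?thesis
    unfolding level_msgs_def msg_space_def lists_of_def[of _ "J + 1"] by (simp add: image_subset_iff)
qed

definition bad_seeds :: "nat \<Rightarrow> nat \<Rightarrow> nat \<Rightarrow> real \<Rightarrow> nat list \<times> nat list \<Rightarrow> (nat \<Rightarrow> nat \<Rightarrow> nat \<times> nat \<Rightarrow> bool) set" where
  "bad_seeds n t J \<tau> = (\<lambda>(T, P). {\<omega>. \<exists>j\<le>J. \<not> accurate n t (2 ^ j) \<tau> (\<omega> j) (nth T) (nth P)})"

text \<open>Bob can test the condition on \<open>T'\<close>, since he knows the pattern, the seed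
  and the message. The distances of \<open>T'\<close> and of Alice's text are then within a factor
  \<open>1 + \<eta>\<close> of each other; multiplying by \<open>1 + \<eta>\<close> makes the answer
  an upper bound, too large by at most \<open>(1 + \<eta>)\<close> squared.\<close>

definition decode ::
  "nat \<Rightarrow> nat \<Rightarrow> nat \<Rightarrow> nat \<Rightarrow> real \<Rightarrow> 'a list \<times> 'a list \<Rightarrow> (nat \<Rightarrow> nat \<Rightarrow> nat \<times> nat \<Rightarrow> bool) \<Rightarrow>
    (nat \<times> (nat \<times> real list) list) list \<Rightarrow> nat \<Rightarrow> real" where
  "decode n t K J \<eta> = (\<lambda>(T2, P) \<omega> msg i.
     let P' = map (label P) P;
         T' = (SOME T'. \<omega> \<notin> bad_seeds n t J (\<eta> / 48) (T', P') \<and> level_msgs n t K J \<eta> \<omega> T' P' = msg)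
     in (1 + \<eta>) * real (mism (nth T') (nth P') (i - 1) {i - 1..<n}) + real (overhang n P T2 (i - 1)))"

lemma level_msgs_determine_mism:
  assumes "0 < \<eta>" "\<eta> \<le> 1" "8 / \<eta> < real K" "s \<le> n" "n \<le> 2 ^ J"
    and "\<omega> \<notin> bad_seeds n t J (\<eta> / 48) (T, P)" "\<omega> \<notin> bad_seeds n t J (\<eta> / 48) (T', P)"
    and eq: "level_msgs n t K J \<eta> \<omega> T P = level_msgs n t K J \<eta> \<omega> T' P"
  shows "real (mism (nth T) (nth P) s {s..<n}) \<le> (1 + \<eta>) * real (mism (nth T') (nth P) s {s..<n})"
proof (rule levels_determine_mism[OF assms(1-5)])
  fix j assume j: "j \<le> J"
  show "accurate n t (2 ^ j) (\<eta> / 48) (\<omega> j) (nth T) (nth P)"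
    "accurate n t (2 ^ j) (\<eta> / 48) (\<omega> j) (nth T') (nth P)"
    using j assms(6,7) by (auto simp: bad_seeds_def)
  have "j \<in> set [0..<J + 1]"
    using j by auto
  with eq show "level_msg n t K (2 ^ j) (\<eta> * 2 ^ j / 8) (\<omega> j) (nth T) (nth P)
      = level_msg n t K (2 ^ j) (\<eta> * 2 ^ j / 8) (\<omega> j) (nth T') (nth P)"
    unfolding level_msgs_def map_eq_conv by blast
qed

lemma decode_correct:
  assumes "0 < \<epsilon>" "\<epsilon> < 1 / 2" "24 / \<epsilon> < real K" "n \<le> 2 ^ J"
    and len: "length T1 = n" "length T2 = n" "length P = n"
    and good: "\<omega> \<notin> bad_seeds n t J (\<epsilon> / 144) (map (label P) T1, map (label P) P)"
  shows "matching_answer \<epsilon> n (T1, P) (T2, P)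
    (decode n t K J (\<epsilon> / 3) (T2, P) \<omega> (level_msgs n t K J (\<epsilon> / 3) \<omega> (map (label P) T1) (map (label P) P)))"
proof -
  define \<eta> where "\<eta> = \<epsilon> / 3"
  define P' where "P' = map (label P) P"
  define T where "T = map (label P) T1"
  define msg where "msg = level_msgs n t K J \<eta> \<omega> T P'"
  define T' where "T' = (SOME T'. \<omega> \<notin> bad_seeds n t J (\<eta> / 48) (T', P') \<and> level_msgs n t K J \<eta> \<omega> T' P' = msg)"
  have \<eta>: "0 < \<eta>" "\<eta> \<le> 1" "8 / \<eta> < real K" "\<eta> / 48 = \<epsilon> / 144"
    using assms by (simp_all add: \<eta>_def)
  have T: "\<omega> \<notin> bad_seeds n t J (\<eta> / 48) (T, P')"
    using good by (simp add: \<eta>(4) T_def P'_def)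
  \<comment> \<open>Alice's own relabelled half is a witness for the choice.\<close>
  have "\<omega> \<notin> bad_seeds n t J (\<eta> / 48) (T', P') \<and> level_msgs n t K J \<eta> \<omega> T' P' = msg"
    unfolding T'_def by (rule someI[of _ T]) (simp add: T msg_def)
  then have T': "\<omega> \<notin> bad_seeds n t J (\<eta> / 48) (T', P')" "level_msgs n t K J \<eta> \<omega> T P' = level_msgs n t K J \<eta> \<omega> T' P'"
    by (simp_all add: msg_def)
  have "approximates \<epsilon> (real (hamming P (substr (T1 @ T2) i (i + n - 1)))) (decode n t K J \<eta> (T2, P) \<omega> msg i)"
    if i: "i \<in> {1..n + 1}" for i
  proof -
    define d where "d = real (mism (nth T) (nth P') (i - 1) {i - 1..<n})"
    define d' where "d' = real (mism (nth T') (nth P') (i - 1) {i - 1..<n})"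
    define b where "b = real (overhang n P T2 (i - 1))"
    have "i - 1 \<le> n"
      using i by auto
    have 1: "d \<le> (1 + \<eta>) * d'"
      unfolding d_def d'_def
      by (rule level_msgs_determine_mism[OF \<eta>(1-3) \<open>i - 1 \<le> n\<close> assms(4) T T'])
    have 2: "d' \<le> (1 + \<eta>) * d"
      unfolding d_def d'_def
      by (rule level_msgs_determine_mism[OF \<eta>(1-3) \<open>i - 1 \<le> n\<close> assms(4) T'(1) T T'(2)[symmetric]])
    have h: "real (hamming P (substr (T1 @ T2) i (i + n - 1))) = d + b"
      using hamming_alignment[OF len i] by (simp add: d_def b_def T_def P'_def)
    have dec: "decode n t K J \<eta> (T2, P) \<omega> msg i = (1 + \<eta>) * d' + b"
      by (simp add: decode_def Let_def d'_def b_def T'_def P'_def)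
    have nn: "0 \<le> d" "0 \<le> b"
      by (simp_all add: d_def b_def)
    have "(1 + \<eta>) * d' \<le> (1 + \<eta>) * ((1 + \<eta>) * d)"
      using 2 \<eta> by (intro mult_left_mono) auto
    also have "\<dots> = ((1 + \<eta>) * (1 + \<eta>)) * d"
      by simp
    also have "\<dots> \<le> (1 + \<epsilon>) * d"
    proof (intro mult_right_mono nn)
      \<comment> \<open>Hence the square of \<open>1 + \<eta>\<close> is at most
        \<open>1 + 3 * \<eta>\<close>, which explains
        \<open>\<eta> = \<epsilon> / 3\<close>.\<close>
      have "\<eta> * \<eta> \<le> 1 * \<eta>"
        using \<eta> by (intro mult_right_mono) auto
      then show "(1 + \<eta>) * (1 + \<eta>) \<le> 1 + \<epsilon>"
        by (simp add: \<eta>_def algebra_simps)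
    qed
    finally have "(1 + \<eta>) * d' \<le> (1 + \<epsilon>) * d" .
    moreover have "b \<le> (1 + \<epsilon>) * b"
      using nn assms(1) by (simp add: algebra_simps)
    ultimately show ?thesis
      unfolding approximates_def h dec using 1 by (simp add: algebra_simps)
  qed
  then show ?thesis
    unfolding matching_answer_def by (simp add: msg_def \<eta>_def T_def P'_def)
qed

text \<open>A number up to \<open>n\<close> fits into \<open>J + 1\<close> bits. The seed index
  takes \<open>2 * (J + 1)\<close> bits; each of the \<open>J + 1\<close> levels takes
  \<open>J + 1\<close> bits for the anchor and \<open>J + 1 + t\<close> bits for each of
  \<open>K\<close> breakpoints with its parities.\<close>

lemma matching_protocol_exists:
  assumes "0 < \<epsilon>" "\<epsilon> < 1 / 2" "24 / \<epsilon> < real K" "n \<le> 2 ^ J" "t > 0"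
    and fail: "real (J + 1) * (real ((n + 1)\<^sup>2) * (2 * exp (- real t * (\<epsilon> / 144)\<^sup>2 / 2))) \<le> 1 / 64"
  shows "\<exists>A B. one_way_protocol
    (matching_inputs n :: (('a list \<times> 'a list) \<times> ('a list \<times> 'a list)) set) (matching_answer \<epsilon> n)
    (2 * (J + 1) + (J + 1 + K * (J + 1 + t)) * (J + 1)) A B"
proof -
  \<comment> \<open>Pairs of relabelled strings: finite for any alphabet, and enough to determine
    which seeds are bad.\<close>
  define X where "X = lists_of {..n} n \<times> lists_of {..n} n"
  \<comment> \<open>There are at most \<open>2 ^ ((J + 1) * (2 * n))\<close> keys, and this exponent
    is at most \<open>2 ^ (2 * J + 1)\<close>, hence below \<open>N\<close>.\<close>
  define N :: nat where "N = 2 ^ (2 * (J + 1))"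
  define key :: "'a list \<times> 'a list \<Rightarrow> nat list \<times> nat list"
    where "key = (\<lambda>(T1, P). (map (label P) T1, map (label P) P))"
  define msg where "msg \<omega> x = (case key x of (T, P) \<Rightarrow> level_msgs n t K J (\<epsilon> / 3) \<omega> T P)"
    for \<omega> and x :: "'a list \<times> 'a list"
  have n1: "n + 1 \<le> 2 ^ (J + 1)"
  proof -
    have "1 \<le> (2::nat) ^ J"
      by simp
    with assms(4) have "n + 1 \<le> 2 * 2 ^ J"
      by linarith
    then show ?thesis
      by simp
  qed
  have inputs: "\<exists>T1 T2 P. x = (T1, P) \<and> y = (T2, P) \<and> length T1 = n \<and> length T2 = n \<and> length P = n"
    if "(x, y) \<in> matching_inputs n" for x y :: "'a list \<times> 'a list"
    using that by (auto simp: matching_inputs_def substr_def)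
  show ?thesis
  proof (rule one_way_protocol_exists[where X = X and N = N and \<Omega> = "seeds n t J" and M = "msg_space n t K J"
        and Bad = "bad_seeds n t J (\<epsilon> / 144)" and key = key and msg = msg and dec = "decode n t K J (\<epsilon> / 3)"])
    show "finite X"
      unfolding X_def by (intro finite_cartesian_product finite_lists_of) auto
    show "card X < 2 ^ N"
    proof -
      have "card X = (n + 1) ^ (2 * n)"
        by (simp add: X_def card_cartesian_product card_lists_of mult_2 power_add)
      also have "\<dots> \<le> (2 ^ (J + 1)) ^ (2 * n)"
        using n1 by (rule power_mono) simp
      also have "\<dots> = 2 ^ ((J + 1) * (2 * n))"
        by (rule power_mult[symmetric])
      also have "\<dots> < (2::nat) ^ N"
      proof (rule power_strict_increasing)
        have "J + 1 \<le> 2 ^ J"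
          using less_exp[of J] by linarith
        then have "(J + 1) * (2 * n) \<le> 2 ^ J * (2 * 2 ^ J)"
          using assms(4) by (intro mult_le_mono) auto
        also have "\<dots> < N"
          by (simp add: N_def power_mult power_mult_distrib[symmetric] flip: power2_eq_square mult_2)
            (simp add: power2_eq_square power_mult_distrib[symmetric])
        finally show "(J + 1) * (2 * n) < N" .
      qed simp
      finally show ?thesis .
    qed
    show "N > 0"
      by (simp add: N_def)
    show "measure_pmf.prob (seeds n t J) (bad_seeds n t J (\<epsilon> / 144) k) \<le> 1 / 64" if "k \<in> X" for k
    proof -
      obtain T P where k: "k = (T, P)"
        by fastforce
      have "T ! m \<le> n" "P ! m \<le> n" if "m < n" for m
      proof -
        have X: "set T \<subseteq> {..n}" "set P \<subseteq> {..n}" "m < length T" "m < length P"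
          using \<open>k \<in> X\<close> that by (auto simp: k X_def lists_of_def)
        show "T ! m \<le> n" "P ! m \<le> n"
          using subsetD[OF X(1) nth_mem[OF X(3)]] subsetD[OF X(2) nth_mem[OF X(4)]] by simp_all
      qed
      then have "measure_pmf.prob (seeds n t J) (bad_seeds n t J (\<epsilon> / 144) k)
          \<le> real (J + 1) * (real ((n + 1)\<^sup>2) * (2 * exp (- real t * (\<epsilon> / 144)\<^sup>2 / 2)))"
        unfolding k bad_seeds_def case_prod_conv using assms by (intro prob_seeds_not_accurate) auto
      with fail show ?thesis
        by linarith
    qed
    show "finite (msg_space n t K J)"
      by (rule finite_msg_space)
    show "N * card (msg_space n t K J) \<le> 2 ^ (2 * (J + 1) + (J + 1 + K * (J + 1 + t)) * (J + 1))"
    proof -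
      have "card (msg_space n t K J) \<le> (2 ^ (J + 1) * (2 ^ (J + 1) * 2 ^ t) ^ K) ^ (J + 1)"
        unfolding card_msg_space using n1 by (intro power_mono mult_le_mono) auto
      also have "\<dots> = 2 ^ ((J + 1 + K * (J + 1 + t)) * (J + 1))"
        by (simp only: power_add[symmetric] power_mult[symmetric] mult.commute[of K])
      finally show ?thesis
        by (simp only: N_def power_add mult_le_mono2)
    qed
  next
    fix x y :: "'a list \<times> 'a list" assume xy: "(x, y) \<in> matching_inputs n"
    then obtain T1 T2 P where x: "x = (T1, P)" "y = (T2, P)"
      and len: "length T1 = n" "length T2 = n" "length P = n"
      using inputs by blast
    show "key x \<in> X"
      using len label_le[of P] by (auto simp: key_def x X_def lists_of_def)
    fix \<omega>
    show "msg \<omega> x \<in> msg_space n t K J"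
      by (simp add: msg_def key_def x level_msgs_in_msg_space)
    assume "\<omega> \<notin> bad_seeds n t J (\<epsilon> / 144) (key x)"
    then show "matching_answer \<epsilon> n x y (decode n t K J (\<epsilon> / 3) y \<omega> (msg \<omega> x))"
      using decode_correct[OF assms(1-4) len] by (simp add: x key_def msg_def)
  qed
qed

section \<open>Choice of parameters and message length\<close>

lemma protocol_parameters:
  fixes \<epsilon> :: real
  assumes "0 < \<epsilon>" "\<epsilon> < 1 / 2" "2 \<le> n"
  obtains J K t :: nat where "24 / \<epsilon> < real K" "n \<le> 2 ^ J" "t > 0"
    "real (J + 1) * (real ((n + 1)\<^sup>2) * (2 * exp (- real t * (\<epsilon> / 144)\<^sup>2 / 2))) \<le> 1 / 64"
    "real (J + 1) \<le> 3 * log 2 (real n)" "real K \<le> 25 / \<epsilon>"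
    "real t \<le> 539137 * (1 / \<epsilon>)\<^sup>2 * log 2 (real n)"
proof -
  define l where "l = log 2 (real n)"
  define J where "J = nat \<lceil>l\<rceil>"
  define K where "K = nat \<lfloor>24 / \<epsilon>\<rfloor> + 1"
  \<comment> \<open>This makes the exponent \<open>t * (\<epsilon> / 144)\<^sup>2 / 2\<close> at
    least \<open>13 * ln n\<close>, so the exponential in the failure bound is at most
    \<open>1 / n ^ 13\<close>.\<close>
  define t where "t = nat \<lceil>26 * ln (real n) * (144 / \<epsilon>)\<^sup>2\<rceil>"
  have l: "1 \<le> l"
    using assms by (simp add: l_def le_log_iff)
  have nl: "real n = 2 powr l"
    using assms by (simp add: l_def)
  have lJ: "l \<le> real J" "real J \<le> l + 1"
    using l by (simp_all add: J_def)
  have "real n \<le> 2 powr real J"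
    unfolding nl using lJ by simp
  then have "real n \<le> real (2 ^ J)"
    by (simp add: powr_realpow)
  then have nJ: "n \<le> 2 ^ J"
    by (simp only: of_nat_le_iff)
  have "l \<le> real n"
  proof -
    have "real n \<le> real (2 ^ n)"
      using less_exp[of n] by (simp only: of_nat_le_iff)
    then have "real n \<le> 2 powr real n"
      by (simp add: powr_realpow)
    then show ?thesis
      using assms by (simp add: l_def log_le_iff)
  qed
  then have "J \<le> n"
    by (simp add: J_def ceiling_le_iff nat_le_iff)
  have ln: "0 < ln (real n)" "ln (real n) \<le> l"
  proof -
    show "0 < ln (real n)"
      using assms by simp
    have "ln (real n) = l * ln 2"
      by (simp add: l_def log_def)
    also have "\<dots> \<le> l * 1"
      using l ln_2_less_1 by (intro mult_left_mono) auto
    finally show "ln (real n) \<le> l"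
      by simp
  qed
  have K: "24 / \<epsilon> < real K" "real K \<le> 24 / \<epsilon> + 1"
    using assms by (simp_all add: K_def) linarith+
  have e: "1 \<le> 1 / \<epsilon>"
    using assms by simp
  have "0 < 26 * ln (real n) * (144 / \<epsilon>)\<^sup>2"
    using ln assms by simp
  then have t: "26 * ln (real n) * (144 / \<epsilon>)\<^sup>2 \<le> real t" "real t \<le> 26 * ln (real n) * (144 / \<epsilon>)\<^sup>2 + 1" "t > 0"
    by (simp_all add: t_def)
  show ?thesis
  proof (rule that[of K J t])
    show "real (J + 1) * (real ((n + 1)\<^sup>2) * (2 * exp (- real t * (\<epsilon> / 144)\<^sup>2 / 2))) \<le> 1 / 64"
    proof -
      have "26 * ln (real n) = 26 * ln (real n) * (144 / \<epsilon>)\<^sup>2 * (\<epsilon> / 144)\<^sup>2"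
        using assms by (simp add: field_simps)
      also have "\<dots> \<le> real t * (\<epsilon> / 144)\<^sup>2"
        using t(1) by (intro mult_right_mono) auto
      finally have "exp (- real t * (\<epsilon> / 144)\<^sup>2 / 2) \<le> exp (- (real 13 * ln (real n)))"
        by simp
      also have "\<dots> = 1 / real n ^ 13"
        using assms by (simp only: exp_minus exp_of_nat_mult) (simp add: field_simps)
      finally have ex: "exp (- real t * (\<epsilon> / 144)\<^sup>2 / 2) \<le> 1 / real n ^ 13" .
      have n2: "n + 1 \<le> n ^ 2"
      proof -
        have "2 * n \<le> n * n"
          using assms(3) by (intro mult_le_mono) auto
        with assms(3) have "n + 1 \<le> n * n"
          by linarith
        then show ?thesis
          by (simp only: power2_eq_square)
      qed
      \<comment> \<open>The factor 128 combines the 2 from the two-sided tail bound with the target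
        \<open>1 / 64\<close>; the powers 2, 4 and 7 of \<open>n\<close> absorb the three
        factors.\<close>
      have "(J + 1) * ((n + 1)\<^sup>2 * 128) \<le> n ^ 2 * ((n ^ 2)\<^sup>2 * n ^ 7)"
      proof (intro mult_le_mono power_mono n2)
        show "J + 1 \<le> n ^ 2"
          using \<open>J \<le> n\<close> n2 by simp
        have "(2::nat) ^ 7 \<le> n ^ 7"
          using assms(3) by (intro power_mono) auto
        then show "128 \<le> n ^ 7"
          by simp
      qed simp
      also have "\<dots> = n ^ 13"
        by (simp flip: power_mult power_add)
      finally have "real ((J + 1) * ((n + 1)\<^sup>2 * 128)) \<le> real (n ^ 13)"
        by (simp only: of_nat_le_iff)
      then have "64 * (real (J + 1) * (real ((n + 1)\<^sup>2) * (2 * (1 / real n ^ 13)))) \<le> 1"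
        using assms by (simp add: field_simps)
      moreover have "real (J + 1) * (real ((n + 1)\<^sup>2) * (2 * exp (- real t * (\<epsilon> / 144)\<^sup>2 / 2)))
          \<le> real (J + 1) * (real ((n + 1)\<^sup>2) * (2 * (1 / real n ^ 13)))"
        using ex by (intro mult_left_mono) auto
      ultimately show ?thesis
        by linarith
    qed
    show "real (J + 1) \<le> 3 * log 2 (real n)"
      using lJ l by (simp add: l_def)
    show "real K \<le> 25 / \<epsilon>"
      using K e by simp
    show "real t \<le> 539137 * (1 / \<epsilon>)\<^sup>2 * log 2 (real n)"
    proof -
      have "26 * ln (real n) * (144 / \<epsilon>)\<^sup>2 \<le> 26 * l * (144 / \<epsilon>)\<^sup>2"
        using ln by (intro mult_right_mono mult_left_mono) auto
      also have "\<dots> = 539136 * (1 / \<epsilon>)\<^sup>2 * l"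
        by (simp add: field_simps)
      finally have "real t \<le> 539136 * (1 / \<epsilon>)\<^sup>2 * l + 1"
        using t(2) by linarith
      moreover have "1 * 1 \<le> (1 / \<epsilon>)\<^sup>2 * l"
        using e l by (intro mult_mono one_le_power) auto
      ultimately show ?thesis
        by (simp add: l_def)
    qed
  qed (use K nJ t in auto)
qed

text \<open>Here \<open>e\<close> stands for \<open>1 / \<epsilon>\<close> and \<open>j\<close> for
  \<open>J + 1\<close>. The dominant term \<open>k * t * j\<close> has order
  \<open>e ^ 3 * l\<^sup>2\<close>; the last estimate relaxes the power of \<open>e\<close> to
  4.\<close>

lemma message_length_bound:
  fixes e l j k t :: real
  assumes "1 \<le> e" "1 \<le> l" "0 \<le> j" "0 \<le> k" "0 \<le> t"
    and "j \<le> 3 * l" "k \<le> 25 * e" "t \<le> 539137 * e\<^sup>2 * l"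
  shows "2 * j + (j + k * (j + t)) * j \<le> 50000000 * e ^ 4 * l\<^sup>2"
proof -
  have e2: "1 \<le> e\<^sup>2" "1 \<le> e ^ 3" "1 \<le> e ^ 4" "e ^ 3 \<le> e ^ 4"
    using assms by (auto intro: one_le_power power_increasing)
  have "3 * l \<le> 3 * e\<^sup>2 * l"
    using e2 assms by (intro mult_right_mono) auto
  then have jt: "j + t \<le> 539140 * e\<^sup>2 * l"
    using assms by linarith
  have "k * (j + t) \<le> (25 * e) * (539140 * e\<^sup>2 * l)"
    using assms jt by (intro mult_mono) auto
  also have "\<dots> = 13478500 * (e ^ 3 * l)"
    by (simp add: power2_eq_square power3_eq_cube)
  finally have "k * (j + t) \<le> 13478500 * (e ^ 3 * l)" .
  moreover have "1 * l \<le> e ^ 3 * l"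
    using e2 assms by (intro mult_right_mono) auto
  ultimately have "2 + (j + k * (j + t)) \<le> 13478505 * (e ^ 3 * l)"
    using assms by linarith
  then have "(2 + (j + k * (j + t))) * j \<le> (13478505 * (e ^ 3 * l)) * (3 * l)"
    using assms e2 by (intro mult_mono) auto
  also have "\<dots> = 40435515 * (e ^ 3 * l\<^sup>2)"
    by (simp add: power2_eq_square)
  also have "\<dots> \<le> 50000000 * (e ^ 4 * l\<^sup>2)"
    using e2 assms by (intro mult_mono mult_nonneg_nonneg) auto
  finally show ?thesis
    by (simp add: algebra_simps)
qed

theorem theorem1:
  "\<exists>C::real. \<forall>(\<epsilon>::real) (n::nat). 0 < \<epsilon> \<and> \<epsilon> < 1 / 2 \<and> 2 \<le> n \<longrightarrow>
     ereal_of_enat (one_way_rand_cc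
        (matching_inputs n :: (('a list \<times> 'a list) \<times> ('a list \<times> 'a list)) set)
        (matching_answer \<epsilon> n))
     \<le> ereal (C * (1 / \<epsilon>) ^ 4 * (log 2 (real n))\<^sup>2)"
proof (intro exI allI impI, elim conjE)
  fix \<epsilon> :: real and n :: nat
  assume asm: "0 < \<epsilon>" "\<epsilon> < 1 / 2" "2 \<le> n"
  obtain J K t :: nat where par: "24 / \<epsilon> < real K" "n \<le> 2 ^ J" "t > 0"
    "real (J + 1) * (real ((n + 1)\<^sup>2) * (2 * exp (- real t * (\<epsilon> / 144)\<^sup>2 / 2))) \<le> 1 / 64"
    and bounds: "real (J + 1) \<le> 3 * log 2 (real n)" "real K \<le> 25 / \<epsilon>"
    "real t \<le> 539137 * (1 / \<epsilon>)\<^sup>2 * log 2 (real n)"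
    using protocol_parameters[OF asm] by blast
  define c where "c = 2 * (J + 1) + (J + 1 + K * (J + 1 + t)) * (J + 1)"
  let ?cc = "one_way_rand_cc
        (matching_inputs n :: (('a list \<times> 'a list) \<times> ('a list \<times> 'a list)) set) (matching_answer \<epsilon> n)"
  have "?cc \<le> enat c"
    unfolding one_way_rand_cc_def
    using matching_protocol_exists[OF asm(1,2) par, where 'a = 'a]
    by (intro Inf_lower) (auto simp: c_def)
  then have "ereal_of_enat ?cc \<le> ereal_of_enat (enat c)"
    by (simp only: ereal_of_enat_le_iff)
  also have "\<dots> = ereal (real c)"
    by simp
  \<comment> \<open>The witness for \<open>C\<close> was left schematic by \<open>exI\<close>; it
    becomes 50000000, independent of \<open>\<epsilon>\<close> and \<open>n\<close>.\<close>
  also have "\<dots> \<le> ereal (50000000 * (1 / \<epsilon>) ^ 4 * (log 2 (real n))\<^sup>2)"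
  proof -
    have "real c = 2 * real (J + 1) + (real (J + 1) + real K * (real (J + 1) + real t)) * real (J + 1)"
      by (simp only: c_def of_nat_add of_nat_mult of_nat_numeral)
    also have "\<dots> \<le> 50000000 * (1 / \<epsilon>) ^ 4 * (log 2 (real n))\<^sup>2"
      using asm bounds by (intro message_length_bound) (auto simp: le_log_iff)
    finally show ?thesis
      by simp
  qed
  finally show "ereal_of_enat ?cc \<le> ereal (50000000 * (1 / \<epsilon>) ^ 4 * (log 2 (real n))\<^sup>2)" .
qed

end
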